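(* Let $\mathcal R$ be a division ring and let $v_i,v_j,v_k,v_l,v_m\in\mathcal R^2$ be five pairwise linearly independent vectors (in the right vector space $\mathcal R^2$). Then $$\kappa(i,j,k,l)\,q^{i}_{kj}\,\kappa(m,l,j,i)\,q^{i}_{jk}=1-\kappa(m,j,k,i),$$ $$\kappa(i,j,k,l)\,q^{l}_{ki}\,\kappa(l,k,i,m)\,q^{l}_{ik}=1-\kappa(l,j,k,m),$$ $$q^{l}_{jk}\,\kappa(i,j,k,l)\,q^{l}_{kj}\,\kappa(m,l,j,i)=1-\kappa(i,k,j,m).$$
   Context: Vectors in $\mathcal R^2$ are columns, $v_i=(a_{1i},a_{2i})^T$, and scalars act on the right. For indices $i\ne k$ with $v_i,v_k$ linearly independent and any $j$, the quasi-Pl\"ucker coordinate $q^k_{ij}$ is $$q_{ij}^k=(a_{1i}-a_{1k}a_{2k}^{-1}a_{2i})^{-1}(a_{1j}-a_{1k}a_{2k}^{-1}a_{2j})\quad\text{if }a_{2k}\neq0,$$ $$q_{ij}^k=(a_{2i}-a_{2k}a_{1k}^{-1}a_{1i})^{-1}(a_{2j}-a_{2k}a_{1k}^{-1}a_{1j})\quad\text{if }a_{1k}\ne 0;$$ the two expressions agree when both are defined. The noncommutative cross-ratio of four vectors with indices $i,j,k,l$ is $$\kappa(i,j,k,l)=q^j_{kl}\,q^i_{lk}.$$ *)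

theory Defs
  imports "HOL-Analysis.Finite_Cartesian_Product"
begin

(* The library's modules and vector spaces have commutative scalars and its *s multiplies
   on the left, so the right vector space structure on column vectors is set up here. *)

definition scale_right :: "'a::division_ring ^ 'n \<Rightarrow> 'a \<Rightarrow> 'a ^ 'n" where
  "scale_right x c = (\<chi> s. x $ s * c)"

definition lin_indep_pair :: "'a::division_ring ^ 'n \<Rightarrow> 'a ^ 'n \<Rightarrow> bool" where
  "lin_indep_pair x y \<longleftrightarrow>
     (\<forall>b c. scale_right x b + scale_right y c = 0 \<longrightarrow> b = 0 \<and> c = 0)"

(* quasi_pluecker v k i j is q^k_{ij} for the family v, with entry a_{si} = v i $ s.
   It is meaningful only when v i and v k are linearly independent. *)
definition quasi_pluecker ::
    "('i \<Rightarrow> 'a::division_ring ^ 2) \<Rightarrow> 'i \<Rightarrow> 'i \<Rightarrow> 'i \<Rightarrow> 'a" where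
  "quasi_pluecker v k i j =
     (if v k $ 2 \<noteq> 0 then
        inverse (v i $ 1 - v k $ 1 * inverse (v k $ 2) * v i $ 2) *
          (v j $ 1 - v k $ 1 * inverse (v k $ 2) * v j $ 2)
      else
        inverse (v i $ 2 - v k $ 2 * inverse (v k $ 1) * v i $ 1) *
          (v j $ 2 - v k $ 2 * inverse (v k $ 1) * v j $ 1))"

definition cross_ratio ::
    "('i \<Rightarrow> 'a::division_ring ^ 2) \<Rightarrow> 'i \<Rightarrow> 'i \<Rightarrow> 'i \<Rightarrow> 'i \<Rightarrow> 'a" where
  "cross_ratio v i j k l = quasi_pluecker v j k l * quasi_pluecker v i l k"

(* The two defining expressions agree whenever both make sense, so the order of the
   case distinction in quasi_pluecker is immaterial. *)
lemma quasi_pluecker_alt: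
  fixes v :: "'i \<Rightarrow> 'a::division_ring ^ 2"
  assumes "v k $ 1 \<noteq> 0"
  shows "quasi_pluecker v k i j =
           inverse (v i $ 2 - v k $ 2 * inverse (v k $ 1) * v i $ 1) *
             (v j $ 2 - v k $ 2 * inverse (v k $ 1) * v j $ 1)"
proof (cases "v k $ 2 = 0")
  case True
  then show ?thesis by (simp add: quasi_pluecker_def)
next
  case False
  define c where "c = v k $ 1 * inverse (v k $ 2)"
  have c0: "c \<noteq> 0" using assms False by (simp add: c_def)
  have ci: "v k $ 2 * inverse (v k $ 1) = inverse c"
    using assms False by (simp add: c_def nonzero_inverse_mult_distrib)
  have e: "v n $ 2 - inverse c * v n $ 1 = - inverse c * (v n $ 1 - c * v n $ 2)" for n
    using c0 by (simp add: algebra_simps mult.assoc[symmetric])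
  have cancel: "inverse (- inverse c * x) * (- inverse c * y) = inverse x * y" for x y
  proof (cases "x = 0")
    case True
    then show ?thesis by simp
  next
    case x: False
    have "inverse (- inverse c * x) = inverse x * - c"
      using x c0 by (simp add: nonzero_inverse_mult_distrib nonzero_inverse_minus_eq)
    moreover have "inverse x * - c * (- inverse c * y) = inverse x * (c * inverse c) * y"
      by (simp add: mult.assoc)
    ultimately show ?thesis using c0 by simp
  qed
  show ?thesis
    unfolding ci e cancel using False by (simp add: quasi_pluecker_def c_def)
qed

end

(* Fix k. Up to a left factor, which cancels, q^k_{ij} = f(v_i)^{-1} f(v_j) for the right-linear
   functional f that vanishes exactly on the line of v_k. Hence q^j_{ix} and q^i_{jx} are the
   coordinates of v_x in the basis v_i, v_j, and applying the functional of v_m to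
   v_x = v_i q^j_{ix} + v_j q^i_{jx} gives the three-term relation
   q^m_{px} = q^m_{pi} q^j_{ix} + q^m_{pj} q^i_{jx}. Taking m = x, p = i gives the skew-symmetry
   q^j_{ix} = - q^x_{ij} q^i_{jx}. With q^k_{ab} q^k_{bc} = q^k_{ac}, these relations reduce each
   identity to one instance of the three-term relation. *)
theory Submission
  imports Defs "HOL-Analysis.Cartesian_Space"
begin

text \<open>The functional \<open>f\<close> of the overview for the line spanned by
  \<open>u\<close>. The case split copies the one in \<open>quasi_pluecker\<close>, so
  quasi-Pluecker coordinates factor through it by mere unfolding.\<close>

definition line_functional :: "'a::division_ring ^ 2 \<Rightarrow> 'a ^ 2 \<Rightarrow> 'a" where
  "line_functional u x =
     (if u $ 2 \<noteq> 0 then x $ 1 - u $ 1 * inverse (u $ 2) * x $ 2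
      else x $ 2 - u $ 2 * inverse (u $ 1) * x $ 1)"

lemma quasi_pluecker_eq_line_functional:
  "quasi_pluecker v k i j =
     inverse (line_functional (v k) (v i)) * line_functional (v k) (v j)"
  by (simp add: quasi_pluecker_def line_functional_def)

lemma line_functional_add:
  "line_functional u (x + y) = line_functional u x + line_functional u y"
  by (simp add: line_functional_def algebra_simps)

lemma line_functional_diff:
  "line_functional u (x - y) = line_functional u x - line_functional u y"
  by (simp add: line_functional_def algebra_simps)

lemma line_functional_scale_right:
  "line_functional u (scale_right x c) = line_functional u x * c"
  by (simp add: line_functional_def scale_right_def algebra_simps)

lemma lin_indep_pair_sym: "lin_indep_pair x y \<Longrightarrow> lin_indep_pair y x"
  unfolding lin_indep_pair_def by (metis add.commute)

lemma lin_indep_pair_nonzero: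
  fixes x y :: "'a::division_ring ^ 'n"
  assumes "lin_indep_pair x y"
  shows "x \<noteq> 0"
proof
  assume "x = 0"
  then have "scale_right x 1 + scale_right y 0 = 0"
    by (simp add: scale_right_def vec_eq_iff)
  with assms show False
    unfolding lin_indep_pair_def by (metis zero_neq_one)
qed

lemma line_functional_self: "line_functional u u = 0"
  by (simp add: line_functional_def mult.assoc)

text \<open>The equation lets one coordinate of \<open>x\<close> determine the other; the coordinate
  in which \<open>u\<close> is known to be nonzero yields the multiplier \<open>c\<close>.\<close>

lemma line_functional_eq_0D:
  fixes u x :: "'a::division_ring ^ 2"
  assumes "u \<noteq> 0" and "line_functional u x = 0"
  obtains c where "x = scale_right u c"
proof (cases "u $ 2 = 0")
  case True
  with assms(1) have "u $ 1 \<noteq> 0" by (auto simp: vec_eq_iff forall_2)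
  moreover have "x $ 2 = 0" using assms(2) True by (simp add: line_functional_def)
  ultimately have "x = scale_right u (inverse (u $ 1) * x $ 1)"
    using True by (simp add: scale_right_def vec_eq_iff forall_2 mult.assoc[symmetric])
  then show thesis by (rule that)
next
  case False
  with assms(2) have "x = scale_right u (inverse (u $ 2) * x $ 2)"
    by (simp add: line_functional_def scale_right_def vec_eq_iff forall_2 mult.assoc[symmetric])
  then show thesis by (rule that)
qed

text \<open>A zero value would put \<open>x\<close> on the line of \<open>u\<close>. This makes the
  inverses in the quasi-Pluecker coordinates genuine, so that factors may be cancelled.\<close>

lemma line_functional_neq_0:
  fixes u x :: "'a::division_ring ^ 2"
  assumes "lin_indep_pair u x"
  shows "line_functional u x \<noteq> 0"
proof
  assume "line_functional u x = 0"
  then obtain c where "x = scale_right u c"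
    using assms lin_indep_pair_nonzero line_functional_eq_0D by metis
  then have "scale_right u c + scale_right x (- 1) = 0"
    by (simp add: scale_right_def vec_eq_iff)
  with assms have "- 1 = (0::'a)"
    unfolding lin_indep_pair_def by blast
  then show False by simp
qed

text \<open>The difference \<open>w\<close> of both sides is killed by the functionals of
  \<open>v i\<close> and \<open>v j\<close>. The second puts \<open>w\<close> on the line of
  \<open>v j\<close>; the first, nonzero at \<open>v j\<close>, then forces
  \<open>w = 0\<close>.\<close>

lemma quasi_pluecker_coordinates:
  fixes v :: "'i \<Rightarrow> 'a::division_ring ^ 2"
  assumes "lin_indep_pair (v i) (v j)"
  shows "v x = scale_right (v i) (quasi_pluecker v j i x)
              + scale_right (v j) (quasi_pluecker v i j x)"
proof -
  define w where "w = v x - (scale_right (v i) (quasi_pluecker v j i x)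
              + scale_right (v j) (quasi_pluecker v i j x))"
  have ij: "line_functional (v i) (v j) \<noteq> 0" and ji: "line_functional (v j) (v i) \<noteq> 0"
    using assms lin_indep_pair_sym line_functional_neq_0 by blast+
  have wj: "line_functional (v j) w = 0" and wi: "line_functional (v i) w = 0"
    unfolding w_def
    using ij ji
    by (simp_all add: line_functional_diff line_functional_add line_functional_scale_right
        line_functional_self quasi_pluecker_eq_line_functional mult.assoc[symmetric])
  have "v j \<noteq> 0" using assms lin_indep_pair_sym lin_indep_pair_nonzero by blast
  then obtain c where c: "w = scale_right (v j) c"
    using wj line_functional_eq_0D by metis
  with wi ij have "c = 0" by (simp add: line_functional_scale_right)
  with c have "w = 0" by (simp add: scale_right_def vec_eq_iff)
  then show ?thesis by (simp add: w_def)
qed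

lemma quasi_pluecker_self:
  assumes "lin_indep_pair (v k) (v i)"
  shows "quasi_pluecker v k i i = 1"
  using line_functional_neq_0[OF assms] by (simp add: quasi_pluecker_eq_line_functional)

text \<open>The inner factors cancel, as the functional of \<open>v k\<close> is nonzero at
  \<open>v b\<close>. Taking \<open>c = a\<close> together with \<open>quasi_pluecker_self\<close>
  shows that swapping the lower indices inverts a coordinate.\<close>

lemma quasi_pluecker_mult:
  assumes "lin_indep_pair (v k) (v b)"
  shows "quasi_pluecker v k a b * quasi_pluecker v k b c = quasi_pluecker v k a c"
  using line_functional_neq_0[OF assms]
  by (simp add: quasi_pluecker_eq_line_functional mult.assoc)
     (simp add: mult.assoc[symmetric])

text \<open>The index \<open>p\<close> enters only through a common left factor, so it may coincide
  with \<open>i\<close> or \<open>x\<close>. For \<open>p = m\<close> that factor is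
  \<open>inverse 0 = 0\<close> and both sides vanish.\<close>

lemma quasi_pluecker_three_term:
  assumes "lin_indep_pair (v i) (v j)"
  shows "quasi_pluecker v m p x =
           quasi_pluecker v m p i * quasi_pluecker v j i x
           + quasi_pluecker v m p j * quasi_pluecker v i j x"
proof -
  have "line_functional (v m) (v x) =
          line_functional (v m) (v i) * quasi_pluecker v j i x
          + line_functional (v m) (v j) * quasi_pluecker v i j x"
    using arg_cong[OF quasi_pluecker_coordinates[where v = v, OF assms, of x], of "line_functional (v m)"]
    by (simp add: line_functional_add line_functional_scale_right)
  then show ?thesis
    by (simp add: quasi_pluecker_eq_line_functional[of v m] distrib_left mult.assoc)
qed

lemma quasi_pluecker_skew:
  assumes "lin_indep_pair (v i) (v j)" and "lin_indep_pair (v x) (v i)"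
  shows "quasi_pluecker v x i j * quasi_pluecker v i j x = - quasi_pluecker v j i x"
proof -
  \<comment> \<open>The functional of \<open>v x\<close> kills \<open>v x\<close>, which makes the
    left side of the three-term relation zero.\<close>
  have "quasi_pluecker v x i x = 0"
    by (simp add: quasi_pluecker_eq_line_functional line_functional_self)
  with quasi_pluecker_three_term[where v = v, OF assms(1), of x i x]
  have "quasi_pluecker v j i x + quasi_pluecker v x i j * quasi_pluecker v i j x = 0"
    by (simp add: quasi_pluecker_self[where v = v, OF assms(2)])
  then show ?thesis by (simp add: eq_neg_iff_add_eq_0 add.commute)
qed

theorem mainTheorem2:
  fixes v :: "'i \<Rightarrow> 'a::division_ring ^ 2" and i j k l m :: 'i
  assumes "distinct [i, j, k, l, m]"
    and "pairwise (\<lambda>p q. lin_indep_pair (v p) (v q)) {i, j, k, l, m}"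
  shows "(cross_ratio v i j k l * quasi_pluecker v i k j * cross_ratio v m l j i * quasi_pluecker v i j k
           = 1 - cross_ratio v m j k i)
    \<and> (cross_ratio v i j k l * quasi_pluecker v l k i * cross_ratio v l k i m * quasi_pluecker v l i k
           = 1 - cross_ratio v l j k m)
    \<and> (quasi_pluecker v l j k * cross_ratio v i j k l * quasi_pluecker v l k j * cross_ratio v m l j i
           = 1 - cross_ratio v i k j m)"
proof -
  let ?q = "quasi_pluecker v"
  have ind: "lin_indep_pair (v p) (v r)"
    if "p \<in> {i, j, k, l, m}" "r \<in> {i, j, k, l, m}" "p \<noteq> r" for p r
    using assms(2) that by (auto simp: pairwise_def)
  note mul = quasi_pluecker_mult[where v = v, OF ind] and self = quasi_pluecker_self[where v = v, OF ind]
    and skew = quasi_pluecker_skew[where v = v, OF ind ind] and three = quasi_pluecker_three_term[where v = v, OF ind]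
  have ne: "i \<noteq> j" "i \<noteq> k" "i \<noteq> l" "i \<noteq> m" "j \<noteq> k" "j \<noteq> l" "j \<noteq> m" "k \<noteq> l" "k \<noteq> m" "l \<noteq> m"
    using assms(1) by auto
  note ne = ne ne[symmetric]

  have 1: "cross_ratio v i j k l * ?q i k j * cross_ratio v m l j i * ?q i j k
           = 1 - cross_ratio v m j k i"
  proof -
    \<comment> \<open>The bracketed factors collapse to one coordinate up to sign, which is then
      absorbed by the first factor.\<close>
    have "cross_ratio v i j k l * ?q i k j * cross_ratio v m l j i * ?q i j k
        = ?q j k l * ((?q i l k * ?q i k j) * ?q l j i) * ?q m i j * ?q i j k"
      by (simp add: cross_ratio_def mult.assoc)
    also have "?q i l k * ?q i k j = ?q i l j"
      using ne by (intro mul) auto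
    also have "?q i l j * ?q l j i = - ?q j l i"
      using ne by (intro skew) auto
    also have "?q j k l * - ?q j l i = - (?q j k l * ?q j l i)"
      by simp
    also have "?q j k l * ?q j l i = ?q j k i"
      using ne by (intro mul) auto
    also have "- ?q j k i * ?q m i j * ?q i j k = - (?q j k i * (?q m i j * ?q i j k))"
      by (simp add: mult.assoc)
    \<comment> \<open>Three-term relation for \<open>v k\<close> in the basis \<open>v i\<close>,
      \<open>v j\<close>, normalised at \<open>i\<close> so that one coefficient becomes 1.\<close>
    also have "?q m i j * ?q i j k = ?q m i k - ?q j i k"
      using three[of i j m i k] self[of m i] ne by simp
    also have "- (?q j k i * (?q m i k - ?q j i k)) = ?q j k i * ?q j i k - ?q j k i * ?q m i k"
      by (simp add: right_diff_distrib)
    also have "?q j k i * ?q j i k = 1"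
      using mul[of j i k k] self[of j k] ne by simp
    finally show ?thesis by (simp add: cross_ratio_def)
  qed

  have 2: "cross_ratio v i j k l * ?q l k i * cross_ratio v l k i m * ?q l i k
           = 1 - cross_ratio v l j k m"
  proof -
    have "cross_ratio v i j k l * ?q l k i * cross_ratio v l k i m * ?q l i k
        = ?q j k l * (?q i l k * ?q l k i) * ?q k i m * (?q l m i * ?q l i k)"
      by (simp add: cross_ratio_def mult.assoc)
    also have "?q l m i * ?q l i k = ?q l m k"
      using ne by (intro mul) auto
    also have "?q i l k * ?q l k i = - ?q k l i"
      using ne by (intro skew) auto
    also have "?q j k l * - ?q k l i * ?q k i m = - (?q j k l * (?q k l i * ?q k i m))"
      by (simp add: mult.assoc)
    also have "?q k l i * ?q k i m = ?q k l m"
      using ne by (intro mul) auto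
    \<comment> \<open>Here \<open>v m\<close> is expanded in the basis \<open>v k\<close>,
      \<open>v l\<close>, with the functional of \<open>v j\<close> normalised at
      \<open>k\<close>.\<close>
    also have "?q j k l * ?q k l m = ?q j k m - ?q l k m"
      using three[of k l j k m] self[of j k] ne by simp
    also have "- (?q j k m - ?q l k m) * ?q l m k = ?q l k m * ?q l m k - ?q j k m * ?q l m k"
      by (simp add: left_diff_distrib)
    also have "?q l k m * ?q l m k = 1"
      using mul[of l m k k] self[of l k] ne by simp
    finally show ?thesis by (simp add: cross_ratio_def)
  qed

  have 3: "?q l j k * cross_ratio v i j k l * ?q l k j * cross_ratio v m l j i
           = 1 - cross_ratio v i k j m"
  proof -
    \<comment> \<open>In this grouping the skew relation applies twice, so the signs cancel.\<close>
    have "?q l j k * cross_ratio v i j k l * ?q l k j * cross_ratio v m l j i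
        = (?q l j k * ?q j k l) * (?q i l k * (?q l k j * ?q l j i)) * ?q m i j"
      by (simp add: cross_ratio_def mult.assoc)
    also have "?q l k j * ?q l j i = ?q l k i"
      using ne by (intro mul) auto
    also have "?q i l k * ?q l k i = - ?q k l i"
      using ne by (intro skew) auto
    also have "?q l j k * ?q j k l = - ?q k j l"
      using ne by (intro skew) auto
    also have "- ?q k j l * - ?q k l i = ?q k j l * ?q k l i"
      by simp
    also have "?q k j l * ?q k l i = ?q k j i"
      using ne by (intro mul) auto
    \<comment> \<open>Now \<open>v j\<close> itself is expanded, in the basis \<open>v i\<close>,
      \<open>v m\<close>; with \<open>p = x = j\<close> the left side of the three-term relation is
      1.\<close>
    also have "?q k j i * ?q m i j = 1 - ?q k j m * ?q i m j"
      using three[of i m k j j] self[of k j] ne by (simp add: eq_diff_eq)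
    finally show ?thesis by (simp add: cross_ratio_def)
  qed

  show ?thesis using 1 2 3 by blast
qed

end
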